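(* Let $F_X$ and $F_Y$ be two cdfs, of random variables $X$ and $Y$ respectively, such that there exists $d\in\mathbb{R}$ satisfying $F_Y(d)<1$ and $F_X(x)\geq F_Y(x)$ for every $x\geq d$. Let $\{X_n:n\in\mathbb{N}\}$ and $\{Y_n:n\in\mathbb{N}\}$ be two sequences of iid random variables with respective parent distribution functions $F_X$ and $F_Y$ and respective sequences of (upper) $k$th record values $\{R_n^{(k)}:n\in\mathbb{N}\}$ and $\{S_n^{(k)}:n\in\mathbb{N}\}$. Then $R_n^{(k)}\leq_{L_1\text{-ast}} S_n^{(k)}$, as $n\to\infty$, for every $k\in\mathbb{N}$ if $\max\{E|X|,E|Y|\}<\infty$; and $R_n^{(k)}\leq_{\mathcal{W}_2\text{-ast}} S_n^{(k)}$, as $n\to\infty$, for every $k\in\mathbb{N}$ if $\max\{E(X^2),E(Y^2)\}<\infty$.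
   Context: $X_{i:m}$ denotes the $i$th smallest among $X_1,\ldots,X_m$. For $k\in\mathbb{N}$, the upper $k$th record times are $T_1^{(k)}=1$ and $T_{n+1}^{(k)}=\min\{i\in\mathbb{N}: X_{i:i+k-1}>X_{T_n^{(k)}:T_n^{(k)}+k-1}\}$, and the upper $k$th record values are $R_n^{(k)}=X_{T_n^{(k)}:T_n^{(k)}+k-1}$. $S_n^{(k)}$ is defined likewise from $\{Y_n\}$. The cdfs of $R_n^{(k)}$ and $S_n^{(k)}$ are taken, following Dziubdziela and Kopociński, to be $\phi_{n,k}(F_X(x))$ and $\phi_{n,k}(F_Y(x))$ respectively, where $\phi_{n,k}(u)=\frac{1}{(n-1)!}\int_0^{-k\ln(1-u)}y^{n-1}e^{-y}\,dy$ for $u\in[0,1]$. For a cdf $F$, $F^{\leftarrow}(u)=\inf\{x\in\mathbb{R}: F(x)\ge u\}$ for $u\in(0,1)$. For sequences of random variables $U_n,V_n$ with cdfs $F_{U_n},F_{V_n}$: $U_n\leq_{L_1\text{-ast}}V_n$, as $n\to\infty$, means $\lim_{n\to\infty}\int_{\{x\in\mathbb{R}:F_{U_n}(x)<F_{V_n}(x)\}}|F_{U_n}(x)-F_{V_n}(x)|\,dx=0$; $U_n\leq_{\mathcal{W}_2\text{-ast}}V_n$, as $n\to\infty$, means $\lim_{n\to\infty}\int_{\{u\in(0,1):F_{U_n}^{\leftarrow}(u)>F_{V_n}^{\leftarrow}(u)\}}(F_{U_n}^{\leftarrow}(u)-F_{V_n}^{\leftarrow}(u))^2\,du=0$. *)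

theory Defs
  imports "HOL-Probability.Probability"
begin

text \<open>Sequences are indexed by the positive integers; the values at index \<open>0\<close> are irrelevant.\<close>

definition order_stat :: "(nat \<Rightarrow> real) \<Rightarrow> nat \<Rightarrow> nat \<Rightarrow> real" where
  "order_stat x i m = sort (map x [1..<Suc m]) ! (i - 1)"

text \<open>If no further record occurs, the minimum is over the empty set and \<open>LEAST\<close> returns an
  unspecified index.\<close>

fun record_time :: "nat \<Rightarrow> (nat \<Rightarrow> real) \<Rightarrow> nat \<Rightarrow> nat" where
  "record_time k x 0 = 0"
| "record_time k x (Suc 0) = 1"
| "record_time k x (Suc (Suc n)) =
     (LEAST i. 1 \<le> i \<and> order_stat x i (i + k - 1) >
        order_stat x (record_time k x (Suc n)) (record_time k x (Suc n) + k - 1))"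

definition record_value :: "nat \<Rightarrow> (nat \<Rightarrow> 'a \<Rightarrow> real) \<Rightarrow> nat \<Rightarrow> 'a \<Rightarrow> real" where
  "record_value k X n \<omega> =
     (let x = (\<lambda>i. X i \<omega>); t = record_time k x n in order_stat x t (t + k - 1))"

text \<open>At \<open>u = 1\<close> the upper limit \<open>- k ln (1 - u)\<close> is \<open>\<infinity>\<close>, whereas \<open>ln 0 = 0\<close> in HOL.\<close>

definition record_phi :: "nat \<Rightarrow> nat \<Rightarrow> real \<Rightarrow> real" where
  "record_phi n k u = 1 / fact (n - 1) *
     (LBINT y = 0..(if u < 1 then ereal (- real k * ln (1 - u)) else \<infinity>). y ^ (n - 1) * exp (- y))"

text \<open>The cdf that, by convention (Dziubdziela and Kopocinski), is assigned to the \<open>n\<close>th upper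
  \<open>k\<close>th record value of an iid sequence with parent cdf \<open>F\<close>, whether or not \<open>F\<close> is continuous.\<close>

definition record_cdf :: "nat \<Rightarrow> (real \<Rightarrow> real) \<Rightarrow> nat \<Rightarrow> real \<Rightarrow> real" where
  "record_cdf k F n x = record_phi n k (F x)"

text \<open>The convention is exact for a given sequence. This can fail when \<open>F\<close> has atoms, in which
  case even the existence of all records is not guaranteed.\<close>

definition has_record_law ::
    "'a measure \<Rightarrow> (nat \<Rightarrow> 'a \<Rightarrow> real) \<Rightarrow> (real \<Rightarrow> real) \<Rightarrow> nat \<Rightarrow> bool" where
  "has_record_law M X F k \<longleftrightarrow>
     (\<forall>n\<ge>1. cdf (distr M borel (record_value k X n)) = record_cdf k F n)"

definition quantile :: "(real \<Rightarrow> real) \<Rightarrow> real \<Rightarrow> real" where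
  "quantile F u = Inf {x. F x \<ge> u}"

text \<open>Both orders depend on the random variables only through their cdfs. The integrals are taken
  in \<open>[0, \<infinity>]\<close>, so that a divergent integral is not counted as \<open>0\<close>.\<close>

definition L1_ast_cdf :: "(nat \<Rightarrow> real \<Rightarrow> real) \<Rightarrow> (nat \<Rightarrow> real \<Rightarrow> real) \<Rightarrow> bool" where
  "L1_ast_cdf F G \<longleftrightarrow>
     (\<lambda>n. \<integral>\<^sup>+x\<in>{x. F n x < G n x}. ennreal \<bar>F n x - G n x\<bar> \<partial>lborel) \<longlonglongrightarrow> 0"

definition W2_ast_cdf :: "(nat \<Rightarrow> real \<Rightarrow> real) \<Rightarrow> (nat \<Rightarrow> real \<Rightarrow> real) \<Rightarrow> bool" where
  "W2_ast_cdf F G \<longleftrightarrow>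
     (\<lambda>n. \<integral>\<^sup>+u\<in>{u\<in>{0<..<1}. quantile (F n) u > quantile (G n) u}.
        ennreal ((quantile (F n) u - quantile (G n) u)\<^sup>2) \<partial>lborel) \<longlonglongrightarrow> 0"

definition L1_ast ::
    "'a measure \<Rightarrow> (nat \<Rightarrow> 'a \<Rightarrow> real) \<Rightarrow> 'b measure \<Rightarrow> (nat \<Rightarrow> 'b \<Rightarrow> real) \<Rightarrow> bool" where
  "L1_ast M U N V \<longleftrightarrow>
     L1_ast_cdf (\<lambda>n. cdf (distr M borel (U n))) (\<lambda>n. cdf (distr N borel (V n)))"

definition W2_ast ::
    "'a measure \<Rightarrow> (nat \<Rightarrow> 'a \<Rightarrow> real) \<Rightarrow> 'b measure \<Rightarrow> (nat \<Rightarrow> 'b \<Rightarrow> real) \<Rightarrow> bool" where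
  "W2_ast M U N V \<longleftrightarrow>
     W2_ast_cdf (\<lambda>n. cdf (distr M borel (U n))) (\<lambda>n. cdf (distr N borel (V n)))"

definition iid_with_cdf :: "'a measure \<Rightarrow> (nat \<Rightarrow> 'a \<Rightarrow> real) \<Rightarrow> (real \<Rightarrow> real) \<Rightarrow> bool" where
  "iid_with_cdf M X F \<longleftrightarrow>
     prob_space.indep_vars M (\<lambda>_. borel) X {1..} \<and> (\<forall>i\<ge>1. cdf (distr M borel (X i)) = F)"

end

theory Submission
  imports Defs
begin

text \<open>
  The cdf of the \<open>n\<close>th record value is the parent cdf distorted by the increasing bijection
  \<open>record_phi n k\<close> of the unit interval. Put \<open>p = F_Y d < 1\<close>. On \<open>[0, p]\<close> the slope of this
  distortion is at most \<open>L\<^sup>m / m! * k / (1 - p)\<close> with \<open>m = n - 1\<close> and \<open>L = - k ln (1 - p)\<close>, which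
  tends to \<open>0\<close> as \<open>n\<close> grows: the records leave every region in which the parent cdf stays away
  from \<open>1\<close> (\<open>record_phi_deriv_le\<close>, \<open>slope_bound_tendsto_0\<close>). Only such a region can violate
  either order, because the distortion preserves the inequality \<open>F_X \<ge> F_Y\<close> on \<open>[d, \<infinity>)\<close>.

  For the \<open>L\<^sub>1\<close> order, the violation lives on \<open>x \<le> d\<close>, and there the distorted \<open>F_Y\<close> is at most
  the slope bound times \<open>F_Y x\<close>. The integral of \<open>F_Y\<close> up to \<open>d\<close> is the mean of the positive part
  of \<open>d - Y\<close> and so is finite (\<open>nn_integral_cdf_atMost\<close>).

  For the Wasserstein order, the violation lives on levels \<open>u \<le> record_phi n k p\<close>. Substituting
  \<open>u = record_phi n k v\<close> turns the quantiles of the record cdfs into the parent quantiles at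
  \<open>v\<close>, at the price of the slope as a weight (\<open>distorted_quantile_excess_le\<close>). What is left is the
  slope bound times the squared \<open>L\<^sub>2\<close> distance of the parent quantile functions, which is controlled
  by the second moments (\<open>quantile_distance_le\<close>).
\<close>

section \<open>The Gamma distribution function\<close>

text \<open>On \<open>x \<ge> 0\<close> this is the cdf of the Gamma distribution with shape \<open>m + 1\<close>, as in
  \<open>erlang_CDF\<close>. The formula is kept on the negative half-line as well, where the cdf is \<open>0\<close>, so that
  the function is differentiable at \<open>0\<close> for every \<open>m\<close>.\<close>

definition gamma_cdf :: "nat \<Rightarrow> real \<Rightarrow> real" where
  "gamma_cdf m x = 1 - (\<Sum>j\<le>m. x ^ j * exp (- x) / fact j)"

lemma DERIV_gamma_cdf: "(gamma_cdf m has_real_derivative x ^ m * exp (- x) / fact m) (at x)"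
proof (induction m)
  case 0
  show ?case
    unfolding gamma_cdf_def by (auto intro!: derivative_eq_intros)
next
  case (Suc m)
  have eq: "gamma_cdf (Suc m) = (\<lambda>x. gamma_cdf m x - x ^ Suc m * exp (- x) / fact (Suc m))"
    by (auto simp: gamma_cdf_def fun_eq_iff)
  have "((\<lambda>x. x ^ Suc m * exp (- x)) has_real_derivative
      real (Suc m) * x ^ m * exp (- x) - x ^ Suc m * exp (- x)) (at x)"
  proof -
    have "((\<lambda>x. exp (- x)) has_real_derivative - exp (- x)) (at x)"
      by (auto intro!: derivative_eq_intros)
    from DERIV_mult[OF DERIV_pow[of "Suc m" x] this] show ?thesis
      by (rule DERIV_cong) (simp add: algebra_simps)
  qed
  from DERIV_diff[OF Suc.IH DERIV_cdivide[OF this, of "fact (Suc m)"]]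
  have "((\<lambda>x. gamma_cdf m x - x ^ Suc m * exp (- x) / fact (Suc m)) has_real_derivative
      x ^ m * exp (- x) / fact m -
      (real (Suc m) * x ^ m * exp (- x) - x ^ Suc m * exp (- x)) / fact (Suc m)) (at x)" .
  moreover have "real (Suc m) * y / fact (Suc m) = y / fact m" for y :: real
    by (simp add: divide_simps)
  from this[of "x ^ m * exp (- x)"]
  have "x ^ m * exp (- x) / fact m -
      (real (Suc m) * x ^ m * exp (- x) - x ^ Suc m * exp (- x)) / fact (Suc m) =
      x ^ Suc m * exp (- x) / fact (Suc m)"
    by (simp add: diff_divide_distrib mult.assoc del: fact_Suc of_nat_Suc)
  ultimately show ?case
    unfolding eq by simp
qed

lemma gamma_cdf_tendsto_1: "(gamma_cdf m \<longlongrightarrow> 1) at_top"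
proof -
  have "((\<lambda>x::real. x ^ j * exp (- x) / fact j) \<longlongrightarrow> 0) at_top" for j
    using tendsto_divide[OF tendsto_power_div_exp_0[of j] tendsto_const[of "fact j"]]
    by (simp add: exp_minus divide_inverse)
  then have "((\<lambda>x::real. 1 - (\<Sum>j\<le>m. x ^ j * exp (- x) / fact j)) \<longlongrightarrow> 1 - (\<Sum>j\<le>m. 0)) at_top"
    by (intro tendsto_intros)
  then show ?thesis
    by (simp add: gamma_cdf_def[abs_def])
qed

lemma gamma_cdf_less_1: "0 \<le> x \<Longrightarrow> gamma_cdf m x < 1"
  by (auto simp: gamma_cdf_def intro!: sum_pos2[where i=0])

text \<open>Transfers the integrals of \<open>y\<^sup>m e\<^sup>-\<^sup>y\<close>, which are available with values in \<open>[0, \<infinity>]\<close>, to the Bochner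
  integral used in \<open>record_phi\<close>.\<close>

lemma set_lebesgue_integral_power_exp:
  assumes "S \<in> sets borel" "S \<subseteq> {0..}" "0 \<le> c"
    and "(\<integral>\<^sup>+y. ennreal (y ^ m * exp (- y)) * indicator S y \<partial>lborel) = ennreal c"
  shows "(LBINT y:S. y ^ m * exp (- y)) = c"
proof -
  have "(LBINT y:S. y ^ m * exp (- y)) =
      enn2real (\<integral>\<^sup>+y. ennreal (indicator S y * (y ^ m * exp (- y))) \<partial>lborel)"
    unfolding set_lebesgue_integral_def using assms(1,2)
    by (subst integral_eq_nn_integral) (auto split: split_indicator intro!: AE_I2)
  also have "(\<integral>\<^sup>+y. ennreal (indicator S y * (y ^ m * exp (- y))) \<partial>lborel) = ennreal c"
    unfolding assms(4)[symmetric] by (intro nn_integral_cong) (auto split: split_indicator)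
  finally show ?thesis using assms(3) by simp
qed

section \<open>The record distortion\<close>

text \<open>The cumulative hazard of the minimum of \<open>k\<close> independent copies, expressed at the level
  \<open>u\<close> of the parent cdf; it is the upper limit of the integral in \<open>record_phi\<close>.\<close>

definition hazard :: "nat \<Rightarrow> real \<Rightarrow> real" where
  "hazard k u = - real k * ln (1 - u)"

lemma hazard_0 [simp]: "hazard k 0 = 0"
  by (simp add: hazard_def)

lemma hazard_nonneg: "0 \<le> u \<Longrightarrow> u < 1 \<Longrightarrow> 0 \<le> hazard k u"
  by (simp add: hazard_def mult_nonneg_nonpos)

lemma hazard_mono: "u \<le> v \<Longrightarrow> v < 1 \<Longrightarrow> hazard k u \<le> hazard k v"
  unfolding hazard_def by (intro mult_left_mono_neg) auto

lemma hazard_pos: "1 \<le> k \<Longrightarrow> 0 < u \<Longrightarrow> u < 1 \<Longrightarrow> 0 < hazard k u"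
  by (simp add: hazard_def mult_pos_neg)

lemma DERIV_hazard: "u < 1 \<Longrightarrow> (hazard k has_real_derivative real k / (1 - u)) (at u)"
  unfolding hazard_def[abs_def] by (auto intro!: derivative_eq_intros)

lemma continuous_on_hazard: "p < 1 \<Longrightarrow> continuous_on {0..p} (hazard k)"
  by (intro continuous_at_imp_continuous_on ballI DERIV_isCont[OF DERIV_hazard]) auto

lemma hazard_tendsto_at_top:
  assumes "1 \<le> k"
  shows "filterlim (hazard k) at_top (at_left 1)"
proof -
  have "filterlim (\<lambda>u::real. 1 - u) (at_right 0) (at_left 1)"
    unfolding filterlim_at
    by (auto intro!: tendsto_eq_intros simp: eventually_at_filter)
  then have "filterlim (\<lambda>u::real. ln (1 - u)) at_bot (at_left 1)"
    by (rule filterlim_compose[OF ln_at_0])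
  then have "filterlim (\<lambda>u::real. - ln (1 - u)) at_top (at_left 1)"
    by (simp add: filterlim_uminus_at_top)
  then have "filterlim (\<lambda>u::real. real k * - ln (1 - u)) at_top (at_left 1)"
    using assms by (intro filterlim_tendsto_pos_mult_at_top[OF tendsto_const]) auto
  then show ?thesis
    by (simp add: hazard_def[abs_def])
qed

lemma record_phi_eq_gamma_cdf:
  assumes "0 \<le> u" "u < 1"
  shows "record_phi (Suc m) k u = gamma_cdf m (hazard k u)"
proof -
  let ?L = "hazard k u"
  have L: "0 \<le> ?L"
    using assms by (rule hazard_nonneg)
  have nonneg: "0 \<le> gamma_cdf m ?L"
    using erlang_CDF_nonneg[of 1 m ?L] L by (simp add: erlang_CDF_def gamma_cdf_def)
  have "(LBINT y:{0..?L}. y ^ m * exp (- y)) = gamma_cdf m ?L * fact m"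
    using nonneg L nn_intergal_power_times_exp_Icc[OF L, of m]
    by (intro set_lebesgue_integral_power_exp) (auto simp: gamma_cdf_def)
  moreover have "record_phi (Suc m) k u = 1 / fact m * (LBINT y=ereal 0..ereal ?L. y ^ m * exp (- y))"
    using assms by (simp add: record_phi_def hazard_def zero_ereal_def)
  ultimately show ?thesis
    using L by (simp add: interval_integral_Icc)
qed

lemma record_phi_0: "record_phi (Suc m) k 0 = 0"
  by (simp add: record_phi_eq_gamma_cdf gamma_cdf_def power_0_left if_distrib[of "\<lambda>x. x / _"] cong: if_cong)

lemma record_phi_1: "record_phi (Suc m) k 1 = 1"
proof -
  have "(LBINT y:{0<..}. y ^ m * exp (- y)) = (LBINT y:{0::real..}. y ^ m * exp (- y))"
    unfolding set_lebesgue_integral_def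
    by (intro integral_cong_AE)
       (auto intro!: AE_I[where N="{0}"] split: split_indicator)
  also have "\<dots> = fact m"
    using nn_intergal_power_times_exp_Ici[of m]
    by (intro set_lebesgue_integral_power_exp) auto
  finally show ?thesis
    by (simp add: record_phi_def zero_ereal_def interval_integral_to_infinity_eq)
qed

definition record_phi_deriv :: "nat \<Rightarrow> nat \<Rightarrow> real \<Rightarrow> real" where
  "record_phi_deriv m k u = hazard k u ^ m * exp (- hazard k u) / fact m * (real k / (1 - u))"

text \<open>The Gamma expression, which agrees with \<open>record_phi\<close> on \<open>[0, 1)\<close>, is differentiated in place of it
  because the substitution rule needs a two-sided derivative at the end point \<open>0\<close>.\<close>

lemma DERIV_gamma_cdf_hazard:
  "u < 1 \<Longrightarrow> ((\<lambda>u. gamma_cdf m (hazard k u)) has_real_derivative record_phi_deriv m k u) (at u)"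
  unfolding record_phi_deriv_def by (rule DERIV_chain2[OF DERIV_gamma_cdf DERIV_hazard])

lemma record_phi_deriv_nonneg: "0 \<le> u \<Longrightarrow> u < 1 \<Longrightarrow> 0 \<le> record_phi_deriv m k u"
  by (simp add: record_phi_deriv_def hazard_nonneg)

lemma record_phi_deriv_pos: "1 \<le> k \<Longrightarrow> 0 < u \<Longrightarrow> u < 1 \<Longrightarrow> 0 < record_phi_deriv m k u"
  by (simp add: record_phi_deriv_def hazard_pos)

lemma continuous_on_record_phi_deriv: "p < 1 \<Longrightarrow> continuous_on {0..p} (record_phi_deriv m k)"
  unfolding record_phi_deriv_def[abs_def] by (intro continuous_intros continuous_on_hazard) auto

text \<open>Continuity at \<open>1\<close> makes the distorted cdf a cdf again: the hazard diverges there, so the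
  Gamma cdf approaches its limit \<open>1\<close>.\<close>

lemma continuous_on_record_phi:
  assumes "1 \<le> k"
  shows "continuous_on {0..1} (record_phi (Suc m) k)"
  unfolding continuous_on_def
proof
  fix u :: real assume u: "u \<in> {0..1}"
  let ?g = "\<lambda>u. gamma_cdf m (hazard k u)"
  show "(record_phi (Suc m) k \<longlongrightarrow> record_phi (Suc m) k u) (at u within {0..1})"
  proof (cases "u = 1")
    case True
    have "(?g \<longlongrightarrow> 1) (at_left 1)"
      using gamma_cdf_tendsto_1 hazard_tendsto_at_top[OF assms] by (rule filterlim_compose)
    moreover have "eventually (\<lambda>u. u \<in> {0<..<1}) (at_left (1::real))"
      by (rule eventually_at_left_real) simp
    then have "eventually (\<lambda>u. record_phi (Suc m) k u = ?g u) (at_left 1)"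
      by eventually_elim (simp add: record_phi_eq_gamma_cdf)
    ultimately have "(record_phi (Suc m) k \<longlongrightarrow> 1) (at_left 1)"
      by (simp cong: tendsto_cong)
    then show ?thesis
      using True by (simp add: record_phi_1 at_within_Icc_at_left)
  next
    case False
    with u have u: "0 \<le> u" "u < 1" by auto
    have "(?g \<longlongrightarrow> ?g u) (at u within {0..1})"
      using DERIV_isCont[OF DERIV_gamma_cdf_hazard[OF u(2), of m k]]
      by (auto simp: isCont_def intro: tendsto_within_subset)
    moreover have "eventually (\<lambda>v. v < 1) (at u within {0..1})"
      using u(2) by (rule order_tendstoD(2)[OF tendsto_ident_at])
    then have "eventually (\<lambda>v. record_phi (Suc m) k v = ?g v) (at u within {0..1})"
      unfolding eventually_at_filter
      by eventually_elim (simp add: record_phi_eq_gamma_cdf)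
    ultimately show ?thesis
      unfolding record_phi_eq_gamma_cdf[OF u] by (simp cong: tendsto_cong)
  qed
qed

lemma strict_mono_on_record_phi:
  assumes "1 \<le> k"
  shows "strict_mono_on {0..1} (record_phi (Suc m) k)"
proof (rule strict_mono_onI)
  fix u v :: real assume uv: "u \<in> {0..1}" "v \<in> {0..1}" "u < v"
  let ?g = "\<lambda>u. gamma_cdf m (hazard k u)"
  show "record_phi (Suc m) k u < record_phi (Suc m) k v"
  proof (cases "v = 1")
    case True
    then show ?thesis
      using uv by (simp add: record_phi_1 record_phi_eq_gamma_cdf hazard_nonneg gamma_cdf_less_1)
  next
    case False
    with uv have v: "0 \<le> u" "v < 1" by auto
    have "?g u < ?g v"
    proof (rule DERIV_pos_imp_increasing_open[OF uv(3)])
      show "\<exists>y. DERIV ?g x :> y \<and> 0 < y" if "u < x" "x < v" for x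
        using DERIV_gamma_cdf_hazard[of x m k] record_phi_deriv_pos[OF assms, of x m] that v by auto
      show "continuous_on {u..v} ?g"
        using v by (intro continuous_at_imp_continuous_on ballI DERIV_isCont[OF DERIV_gamma_cdf_hazard]) auto
    qed
    then show ?thesis
      using v uv by (simp add: record_phi_eq_gamma_cdf)
  qed
qed

text \<open>Bounds \<open>record_phi_deriv\<close> on \<open>[0, p]\<close> by the values of its increasing factors at \<open>p\<close>,
  with the exponential estimated by \<open>1\<close>.\<close>

definition slope_bound :: "nat \<Rightarrow> nat \<Rightarrow> real \<Rightarrow> real" where
  "slope_bound k m p = hazard k p ^ m / fact m * (real k / (1 - p))"

text \<open>The factorial beats every power: these are multiples of the terms of an exponential series.\<close>

lemma slope_bound_tendsto_0: "(\<lambda>m. slope_bound k m p) \<longlonglongrightarrow> 0"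
proof -
  have "(\<lambda>m. hazard k p ^ m / fact m) \<longlonglongrightarrow> 0"
    using summable_LIMSEQ_zero[OF summable_exp[of "hazard k p"]]
    by (simp add: field_simps)
  from tendsto_mult_left_zero[OF this] show ?thesis
    unfolding slope_bound_def .
qed

lemma record_phi_deriv_le:
  assumes "0 \<le> u" "u \<le> p" "p < 1"
  shows "record_phi_deriv m k u \<le> slope_bound k m p"
  unfolding record_phi_deriv_def slope_bound_def
proof (rule mult_mono)
  have L: "0 \<le> hazard k u" "hazard k u \<le> hazard k p"
    using assms by (auto intro: hazard_nonneg hazard_mono)
  then have "hazard k u ^ m * exp (- hazard k u) \<le> hazard k p ^ m * 1"
    by (intro mult_mono power_mono) auto
  then show "hazard k u ^ m * exp (- hazard k u) / fact m \<le> hazard k p ^ m / fact m"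
    by (simp add: divide_right_mono)
  show "real k / (1 - u) \<le> real k / (1 - p)"
    using assms by (intro divide_left_mono) auto
  show "0 \<le> hazard k p ^ m / fact m"
    using L by simp
  show "0 \<le> real k / (1 - u)"
    using assms by simp
qed

lemma record_phi_le_slope_bound:
  assumes "0 \<le> u" "u \<le> p" "p < 1"
  shows "record_phi (Suc m) k u \<le> slope_bound k m p * u"
proof (cases "u = 0")
  case True
  then show ?thesis by (simp add: record_phi_0)
next
  case False
  let ?g = "\<lambda>u. gamma_cdf m (hazard k u)"
  have "\<exists>z. 0 < z \<and> z < u \<and> ?g u - ?g 0 = (u - 0) * record_phi_deriv m k z"
    using assms False by (intro MVT2 DERIV_gamma_cdf_hazard) auto
  then obtain z where z: "0 < z" "z < u" "?g u - ?g 0 = u * record_phi_deriv m k z"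
    by auto
  have "?g 0 = 0"
    using record_phi_0[of m k] by (simp add: record_phi_eq_gamma_cdf)
  then have "?g u = u * record_phi_deriv m k z"
    using z by simp
  also have "\<dots> \<le> u * slope_bound k m p"
    using z assms by (intro mult_left_mono record_phi_deriv_le) auto
  finally show ?thesis
    using assms by (simp add: record_phi_eq_gamma_cdf mult.commute)
qed

section \<open>Quantiles of distorted distribution functions\<close>

text \<open>Makes the Galois connection between a cdf and its quantile function available for
  distorted cdfs, without constructing a measure that has the distorted cdf.\<close>

lemma right_continuous_mono_distorted_cdf:
  assumes "real_distribution A"
    and cont: "continuous_on {0..1} \<phi>" and mono: "mono_on {0..1} \<phi>"
    and "\<phi> 0 = 0" "\<phi> 1 = (1::real)"
  shows "right_continuous_mono (\<lambda>x. \<phi> (cdf A x)) 0 1"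
proof -
  interpret A: real_distribution A by fact
  have range: "cdf A x \<in> {0..1}" for x
    by (simp add: A.cdf_nonneg A.cdf_bounded_prob)
  note compose = continuous_on_tendsto_compose[OF cont _ _ always_eventually[OF allI[OF range]]]
  show ?thesis
  proof
    show "continuous (at_right x) (\<lambda>x. \<phi> (cdf A x))" for x
      using A.cdf_is_right_cont[of x] range[of x] by (auto simp: continuous_within intro!: compose)
    show "mono (\<lambda>x. \<phi> (cdf A x))"
      using range by (auto intro!: monoI mono_onD[OF mono] A.cdf_nondecreasing)
    show "((\<lambda>x. \<phi> (cdf A x)) \<longlongrightarrow> 0) at_bot"
      using compose[OF A.cdf_lim_at_bot] assms by simp
    show "((\<lambda>x. \<phi> (cdf A x)) \<longlongrightarrow> 1) at_top"
      using compose[OF A.cdf_lim_at_top_prob] assms by simp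
  qed
qed

lemma quantile_distorted_cdf:
  assumes "real_distribution A" and mono: "strict_mono_on {0..1::real} (\<phi> :: real \<Rightarrow> real)" and "v \<in> {0..1}"
  shows "quantile (\<lambda>x. \<phi> (cdf A x)) (\<phi> v) = quantile (cdf A) v"
proof -
  interpret A: real_distribution A by fact
  have "\<phi> (cdf A x) \<ge> \<phi> v \<longleftrightarrow> cdf A x \<ge> v" for x
    using assms(3) by (intro strict_mono_on_leD[OF mono] strict_mono_on_less_eq[OF mono])
      (auto simp: A.cdf_nonneg A.cdf_bounded_prob)
  then show ?thesis
    by (simp add: quantile_def)
qed

text \<open>The quantile transform: applied to a uniform variable, the quantile function has law \<open>A\<close>.\<close>

lemma nn_integral_quantile:
  assumes "real_distribution A" and [measurable]: "h \<in> borel_measurable borel"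
  shows "(\<integral>\<^sup>+u\<in>{0<..<1}. h (quantile (cdf A) u) \<partial>lborel) = (\<integral>\<^sup>+x. h x \<partial>A)"
proof -
  interpret A: cdf_distribution A
    using assms(1) by (simp add: cdf_distribution_def)
  have [measurable]: "A.I \<in> borel_measurable (restrict_space lborel {0<..<1})"
    using A.measurable_CI by (simp cong: measurable_cong_sets add: sets_restrict_space)
  have "(\<integral>\<^sup>+x. h x \<partial>A) = (\<integral>\<^sup>+x. h x \<partial>distr (restrict_space lborel {0<..<1}) borel A.I)"
    by (simp only: A.distr_I_eq_M)
  also have "\<dots> = (\<integral>\<^sup>+u. h (A.I u) \<partial>restrict_space lborel {0<..<1})"
    by (rule nn_integral_distr) auto
  also have "\<dots> = (\<integral>\<^sup>+u\<in>{0<..<1}. h (A.I u) \<partial>lborel)"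
    by (rule nn_integral_restrict_space) simp
  finally show ?thesis
    by (simp add: quantile_def)
qed

lemma borel_measurable_square_diff_indicator:
  fixes f g :: "real \<Rightarrow> real"
  assumes "S \<in> sets borel" "f \<in> borel_measurable (restrict_space borel S)"
    "g \<in> borel_measurable (restrict_space borel S)"
  shows "(\<lambda>u. (f u - g u)\<^sup>2 * indicator S u) \<in> borel_measurable borel"
proof -
  have "(\<lambda>u. (f u - g u)\<^sup>2) \<in> borel_measurable (restrict_space borel S)"
    using assms by simp
  then show ?thesis
    using assms(1) by (simp add: borel_measurable_restrict_space_iff mult.commute)
qed

lemma borel_measurable_ennreal_square_diff_indicator:
  fixes f g :: "real \<Rightarrow> real"
  assumes "S \<in> sets borel" "f \<in> borel_measurable (restrict_space borel S)"
    "g \<in> borel_measurable (restrict_space borel S)"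
  shows "(\<lambda>u. ennreal ((f u - g u)\<^sup>2) * indicator S u) \<in> borel_measurable borel"
  using measurable_compose[OF borel_measurable_square_diff_indicator[OF assms] measurable_ennreal]
  by (simp add: ennreal_mult'' ennreal_indicator)

lemma borel_measurable_quantile:
  assumes "real_distribution A"
  shows "quantile (cdf A) \<in> borel_measurable (restrict_space borel {0<..<1})"
proof -
  interpret A: cdf_distribution A using assms by (simp add: cdf_distribution_def)
  show ?thesis
    using A.measurable_CI by (simp add: quantile_def[abs_def])
qed

text \<open>If the quantile of the first cdf exceeds that of the second at level \<open>u\<close>, then at the second
  quantile \<open>y\<close> the cdfs are in the wrong order; so \<open>y < d\<close> and \<open>u\<close> is at most \<open>\<phi> p\<close>. On that range
  of levels, substitute \<open>u = \<phi> v\<close>. The function \<open>g\<close> is a differentiable extension of \<open>\<phi>\<close> beyond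
  the end points of \<open>[0, p]\<close>.\<close>

lemma distorted_quantile_excess_le:
  fixes \<phi> g g' :: "real \<Rightarrow> real"
  assumes A: "real_distribution A" and B: "real_distribution B"
    and p: "cdf B d = p" "p < 1"
    and dom: "\<And>x. d \<le> x \<Longrightarrow> cdf B x \<le> cdf A x"
    and cont: "continuous_on {0..1} \<phi>" and mono: "strict_mono_on {0..1} \<phi>"
    and "\<phi> 0 = 0" "\<phi> 1 = 1"
    and g: "\<And>v. v \<in> {0..p} \<Longrightarrow> g v = \<phi> v"
    and deriv: "\<And>v. v \<in> {0..p} \<Longrightarrow> (g has_real_derivative g' v) (at v)"
    and cont': "continuous_on {0..p} g'"
    and bounds: "\<And>v. v \<in> {0..p} \<Longrightarrow> 0 \<le> g' v" "\<And>v. v \<in> {0..p} \<Longrightarrow> g' v \<le> K"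
  defines "qA \<equiv> quantile (\<lambda>x. \<phi> (cdf A x))" and "qB \<equiv> quantile (\<lambda>x. \<phi> (cdf B x))"
  shows "(\<integral>\<^sup>+u\<in>{u\<in>{0<..<1}. qA u > qB u}. ennreal ((qA u - qB u)\<^sup>2) \<partial>lborel)
    \<le> ennreal K * (\<integral>\<^sup>+u\<in>{0<..<1}. ennreal ((quantile (cdf A) u - quantile (cdf B) u)\<^sup>2) \<partial>lborel)"
proof -
  interpret A: cdf_distribution A using A by (simp add: cdf_distribution_def)
  interpret B: cdf_distribution B using B by (simp add: cdf_distribution_def)
  have mono_phi: "mono_on {0..1} \<phi>"
    using mono by (rule strict_mono_on_imp_mono_on)
  interpret PA: right_continuous_mono "\<lambda>x. \<phi> (cdf A x)" 0 1
    by (rule right_continuous_mono_distorted_cdf) fact+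
  interpret PB: right_continuous_mono "\<lambda>x. \<phi> (cdf B x)" 0 1
    by (rule right_continuous_mono_distorted_cdf) fact+
  have [measurable]: "qA \<in> borel_measurable (restrict_space borel {0<..<1})"
    "qB \<in> borel_measurable (restrict_space borel {0<..<1})"
    unfolding qA_def qB_def quantile_def
    by (auto intro!: borel_measurable_mono_on_fnc PA.mono_I PB.mono_I)
  have p0: "0 \<le> p" using p B.cdf_nonneg by auto
  have bad: "u \<le> \<phi> p" if u: "u \<in> {0<..<1}" and less: "qB u < qA u" for u
  proof -
    let ?y = "qB u"
    have "u \<le> \<phi> (cdf B ?y)"
      using PB.pseudoinverse[of u ?y] u by (simp add: qB_def quantile_def)
    moreover have "\<not> u \<le> \<phi> (cdf A ?y)"
      using PA.pseudoinverse[of u ?y] u less by (simp add: qA_def quantile_def)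
    ultimately have "\<not> cdf B ?y \<le> cdf A ?y"
      using mono_onD[OF mono_phi, of "cdf B ?y" "cdf A ?y"]
      by (auto simp: A.cdf_nonneg A.cdf_bounded_prob B.cdf_nonneg B.cdf_bounded_prob)
    then have "?y \<le> d"
      using dom[of ?y] by linarith
    then have "\<phi> (cdf B ?y) \<le> \<phi> (cdf B d)"
      by (intro monoD[OF PB.mono])
    then show ?thesis
      using \<open>u \<le> \<phi> (cdf B ?y)\<close> p by simp
  qed
  \<comment> \<open>At the end point \<open>0\<close> of the substitution interval the quantile is the infimum of the whole
    line, an unspecified real; cutting off there lets the estimate below hold at every point.\<close>
  define f :: "real \<Rightarrow> real" where "f u = (qA u - qB u)\<^sup>2 * indicator {0<..<1} u" for u
  have f_meas: "f \<in> borel_measurable borel"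
    unfolding f_def[abs_def] by (intro borel_measurable_square_diff_indicator) simp_all
  have g0: "g 0 = 0" and gp: "g p = \<phi> p"
    using g p0 assms by auto
  have f_g: "ennreal (f (g v) * g' v * indicator {0..p} v) \<le>
      ennreal K * (ennreal ((quantile (cdf A) v - quantile (cdf B) v)\<^sup>2) * indicator {0<..<1} v)" for v
  proof (cases "v \<in> {0<..p}")
    case True
    then have v: "v \<in> {0..1}" "v \<in> {0..p}" "v < 1" "0 < v" using p by auto
    have "f (g v) \<le> (quantile (cdf A) v - quantile (cdf B) v)\<^sup>2"
      using v quantile_distorted_cdf[OF A mono v(1)] quantile_distorted_cdf[OF B mono v(1)]
      by (simp add: f_def g qA_def qB_def split: split_indicator)
    then have "f (g v) * g' v \<le> (quantile (cdf A) v - quantile (cdf B) v)\<^sup>2 * K"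
      using bounds[OF v(2)] by (intro mult_mono) (auto simp: f_def)
    moreover have "0 \<le> K"
      using bounds[OF v(2)] by linarith
    ultimately show ?thesis
      using v by (simp add: mult.commute[of "ennreal K"] ennreal_leI flip: ennreal_mult'')
  next
    case False
    then show ?thesis
      by (cases "v = 0") (auto simp: f_def g0)
  qed
  have "(\<integral>\<^sup>+u\<in>{u\<in>{0<..<1}. qA u > qB u}. ennreal ((qA u - qB u)\<^sup>2) \<partial>lborel)
      \<le> (\<integral>\<^sup>+u. f u * indicator {g 0..g p} u \<partial>lborel)"
    by (intro nn_integral_mono) (auto simp: f_def g0 gp bad split: split_indicator)
  also have "\<dots> = (\<integral>\<^sup>+v. f (g v) * g' v * indicator {0..p} v \<partial>lborel)"
    using f_meas by (intro nn_integral_substitution deriv cont' bounds(1) p0)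
      (auto simp: set_borel_measurable_def)
  also have "\<dots> \<le> (\<integral>\<^sup>+v. ennreal K *
      (ennreal ((quantile (cdf A) v - quantile (cdf B) v)\<^sup>2) * indicator {0<..<1} v) \<partial>lborel)"
    by (intro nn_integral_mono f_g)
  also have "\<dots> = ennreal K *
      (\<integral>\<^sup>+v\<in>{0<..<1}. ennreal ((quantile (cdf A) v - quantile (cdf B) v)\<^sup>2) \<partial>lborel)"
    using borel_measurable_ennreal_square_diff_indicator[OF _ borel_measurable_quantile[OF A] borel_measurable_quantile[OF B]]
    by (intro nn_integral_cmult) simp
  finally show ?thesis .
qed

text \<open>Uses \<open>(x - y)\<^sup>2 \<le> 2x\<^sup>2 + 2y\<^sup>2\<close> and the quantile transform.\<close>

lemma quantile_distance_le:
  assumes A: "real_distribution A" and B: "real_distribution B"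
  shows "(\<integral>\<^sup>+u\<in>{0<..<1}. ennreal ((quantile (cdf A) u - quantile (cdf B) u)\<^sup>2) \<partial>lborel)
    \<le> 2 * (\<integral>\<^sup>+x. ennreal (x\<^sup>2) \<partial>A) + 2 * (\<integral>\<^sup>+x. ennreal (x\<^sup>2) \<partial>B)"
proof -
  let ?qA = "quantile (cdf A)" and ?qB = "quantile (cdf B)"
  have square: "ennreal ((x - y)\<^sup>2) \<le> 2 * ennreal (x\<^sup>2) + 2 * ennreal (y\<^sup>2)" for x y :: real
  proof -
    have "(x - y)\<^sup>2 \<le> 2 * x\<^sup>2 + 2 * y\<^sup>2"
      using sum_squares_ge_zero[of "x + y" 0] by (simp add: power2_eq_square algebra_simps)
    then have "ennreal ((x - y)\<^sup>2) \<le> ennreal (2 * x\<^sup>2 + 2 * y\<^sup>2)"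
      by (rule ennreal_leI)
    then show ?thesis
      by (simp add: ennreal_mult)
  qed
  have meas: "(\<lambda>u. ennreal ((quantile (cdf C) u)\<^sup>2) * indicator {0<..<1} u) \<in> borel_measurable lborel"
    if "real_distribution C" for C
    using borel_measurable_ennreal_square_diff_indicator[OF _ borel_measurable_quantile[OF that], of "\<lambda>_. 0"] by simp
  have "(\<integral>\<^sup>+u\<in>{0<..<1}. ennreal ((?qA u - ?qB u)\<^sup>2) \<partial>lborel)
      \<le> (\<integral>\<^sup>+u. 2 * (ennreal ((?qA u)\<^sup>2) * indicator {0<..<1} u) +
                  2 * (ennreal ((?qB u)\<^sup>2) * indicator {0<..<1} u) \<partial>lborel)"
    using square by (intro nn_integral_mono) (auto split: split_indicator)
  also have "\<dots> = 2 * (\<integral>\<^sup>+u\<in>{0<..<1}. ennreal ((?qA u)\<^sup>2) \<partial>lborel) +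
      2 * (\<integral>\<^sup>+u\<in>{0<..<1}. ennreal ((?qB u)\<^sup>2) \<partial>lborel)"
    using meas[OF A] meas[OF B] by (subst nn_integral_add) (auto simp: nn_integral_cmult)
  also have "\<dots> = 2 * (\<integral>\<^sup>+x. ennreal (x\<^sup>2) \<partial>A) + 2 * (\<integral>\<^sup>+x. ennreal (x\<^sup>2) \<partial>B)"
    using nn_integral_quantile[OF A, of "\<lambda>x. ennreal (x\<^sup>2)"] nn_integral_quantile[OF B, of "\<lambda>x. ennreal (x\<^sup>2)"]
    by simp
  finally show ?thesis .
qed

section \<open>The integrated distribution function\<close>

text \<open>Both sides measure the region \<open>y \<le> x \<le> d\<close> under the product of Lebesgue measure and \<open>B\<close>.\<close>

lemma nn_integral_cdf_atMost:
  assumes "real_distribution B"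
  shows "(\<integral>\<^sup>+x\<in>{..d}. ennreal (cdf B x) \<partial>lborel) = (\<integral>\<^sup>+y. ennreal (max 0 (d - y)) \<partial>B)"
proof -
  interpret B: real_distribution B by fact
  interpret P: pair_sigma_finite lborel B ..
  have "(\<integral>\<^sup>+x\<in>{..d}. ennreal (cdf B x) \<partial>lborel)
      = (\<integral>\<^sup>+x. (\<integral>\<^sup>+y. indicator {(x, y). y \<le> x \<and> x \<le> d} (x, y) \<partial>B) \<partial>lborel)"
  proof (intro nn_integral_cong)
    fix x :: real
    have "(\<integral>\<^sup>+y. indicator {(x, y). y \<le> x \<and> x \<le> d} (x, y) \<partial>B)
        = (\<integral>\<^sup>+y. indicator {..x} y * indicator {..d} x \<partial>B)"
      by (intro nn_integral_cong) (auto split: split_indicator)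
    also have "\<dots> = emeasure B {..x} * indicator {..d} x"
      by (subst nn_integral_multc) auto
    finally show "ennreal (cdf B x) * indicator {..d} x
        = (\<integral>\<^sup>+y. indicator {(x, y). y \<le> x \<and> x \<le> d} (x, y) \<partial>B)"
      by (simp add: cdf_def B.emeasure_eq_measure)
  qed
  also have "\<dots> = (\<integral>\<^sup>+y. (\<integral>\<^sup>+x. indicator {(x, y). y \<le> x \<and> x \<le> d} (x, y) \<partial>lborel) \<partial>B)"
    by (rule P.Fubini'[symmetric]) simp
  also have "\<dots> = (\<integral>\<^sup>+y. ennreal (max 0 (d - y)) \<partial>B)"
  proof (intro nn_integral_cong)
    fix y :: real
    have "(\<integral>\<^sup>+x. indicator {(x, y). y \<le> x \<and> x \<le> d} (x, y) \<partial>lborel) = (\<integral>\<^sup>+x. indicator {y..d} x \<partial>lborel)"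
      by (intro nn_integral_cong) (auto split: split_indicator)
    then show "(\<integral>\<^sup>+x. indicator {(x, y). y \<le> x \<and> x \<le> d} (x, y) \<partial>lborel) = ennreal (max 0 (d - y))"
      by (simp add: max_def)
  qed
  finally show ?thesis .
qed

section \<open>Asymptotic orders of record values\<close>

lemma tendsto_0_if_le_slope_bound:
  assumes "C < \<infinity>" and "\<And>m. f (Suc m) \<le> ennreal (slope_bound k m p) * C"
  shows "f \<longlonglongrightarrow> (0::ennreal)"
proof -
  obtain c where c: "C = ennreal c" "0 \<le> c"
    using assms(1) by (cases C) auto
  have "(\<lambda>m. ennreal (slope_bound k m p * c)) \<longlonglongrightarrow> ennreal 0"
    by (intro tendsto_ennrealI tendsto_mult_left_zero slope_bound_tendsto_0)
  then have "(\<lambda>m. f (Suc m)) \<longlonglongrightarrow> 0"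
    using assms(2) c
    by (intro tendsto_sandwich[OF _ _ tendsto_const[of 0], of "\<lambda>m. f (Suc m)"])
       (auto simp: ennreal_mult'')
  then show ?thesis
    by (rule LIMSEQ_imp_Suc)
qed

lemma L1_ast_cdf_record_cdf:
  assumes A: "real_distribution A" and B: "real_distribution B"
    and p: "cdf B d < 1" and dom: "\<And>x. d \<le> x \<Longrightarrow> cdf B x \<le> cdf A x"
    and finite: "(\<integral>\<^sup>+y. ennreal \<bar>y\<bar> \<partial>B) < \<infinity>" and k: "1 \<le> k"
  shows "L1_ast_cdf (record_cdf k (cdf A)) (record_cdf k (cdf B))"
  unfolding L1_ast_cdf_def
proof (rule tendsto_0_if_le_slope_bound)
  interpret A: real_distribution A by fact
  interpret B: real_distribution B by fact
  have ranges: "cdf A x \<in> {0..1}" "cdf B x \<in> {0..1}" for x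
    by (simp_all add: A.cdf_nonneg A.cdf_bounded_prob B.cdf_nonneg B.cdf_bounded_prob)
  have "(\<integral>\<^sup>+x\<in>{..d}. ennreal (cdf B x) \<partial>lborel) \<le> (\<integral>\<^sup>+y. ennreal \<bar>d\<bar> + ennreal \<bar>y\<bar> \<partial>B)"
    unfolding nn_integral_cdf_atMost[OF B]
    by (intro nn_integral_mono) (auto simp flip: ennreal_plus intro!: ennreal_leI)
  also have "\<dots> = ennreal \<bar>d\<bar> + (\<integral>\<^sup>+y. ennreal \<bar>y\<bar> \<partial>B)"
    using B.emeasure_space_1 by (subst nn_integral_add) auto
  also have "\<dots> < \<infinity>"
    using finite by simp
  finally show "(\<integral>\<^sup>+x\<in>{..d}. ennreal (cdf B x) \<partial>lborel) < \<infinity>" .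
  fix m
  have mono: "mono_on {0..1} (record_phi (Suc m) k)"
    using strict_mono_on_record_phi[OF k] by (rule strict_mono_on_imp_mono_on)
  let ?F = "record_cdf k (cdf A) (Suc m)" and ?G = "record_cdf k (cdf B) (Suc m)"
  have "(\<integral>\<^sup>+x\<in>{x. ?F x < ?G x}. ennreal \<bar>?F x - ?G x\<bar> \<partial>lborel) \<le>
    (\<integral>\<^sup>+x. ennreal (slope_bound k m (cdf B d)) * (ennreal (cdf B x) * indicator {..d} x) \<partial>lborel)"
  proof (intro nn_integral_mono)
    fix x
    show "ennreal \<bar>?F x - ?G x\<bar> * indicator {x. ?F x < ?G x} x
      \<le> ennreal (slope_bound k m (cdf B d)) * (ennreal (cdf B x) * indicator {..d} x)"
    proof (cases "?F x < ?G x")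
      case True
      have "\<not> cdf B x \<le> cdf A x"
        using mono_onD[OF mono ranges(2) ranges(1), of x x] True by (auto simp: record_cdf_def)
      then have x: "x \<le> d"
        using dom[of x] by linarith
      have "0 \<le> ?F x"
        using mono_onD[OF mono _ ranges(1), of 0 x] ranges(1)[of x]
        by (simp add: record_cdf_def record_phi_0)
      then have "\<bar>?F x - ?G x\<bar> \<le> ?G x"
        using True by simp
      also have "\<dots> \<le> slope_bound k m (cdf B d) * cdf B x"
        unfolding record_cdf_def using x p
        by (intro record_phi_le_slope_bound B.cdf_nonneg B.cdf_nondecreasing)
      finally show ?thesis
        using x True by (simp add: B.cdf_nonneg flip: ennreal_mult'')
    qed simp
  qed
  also have "\<dots> = ennreal (slope_bound k m (cdf B d)) * (\<integral>\<^sup>+x\<in>{..d}. ennreal (cdf B x) \<partial>lborel)"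
  proof (rule nn_integral_cmult)
    have "cdf B \<in> borel_measurable borel"
      by (intro borel_measurable_mono monoI B.cdf_nondecreasing)
    then show "(\<lambda>x. ennreal (cdf B x) * indicator {..d} x) \<in> borel_measurable lborel"
      by simp
  qed
  finally show "(\<integral>\<^sup>+x\<in>{x. ?F x < ?G x}. ennreal \<bar>?F x - ?G x\<bar> \<partial>lborel)
    \<le> ennreal (slope_bound k m (cdf B d)) * (\<integral>\<^sup>+x\<in>{..d}. ennreal (cdf B x) \<partial>lborel)" .
qed

lemma W2_ast_cdf_record_cdf:
  assumes A: "real_distribution A" and B: "real_distribution B"
    and p: "cdf B d < 1" and dom: "\<And>x. d \<le> x \<Longrightarrow> cdf B x \<le> cdf A x"
    and finite: "(\<integral>\<^sup>+x. ennreal (x\<^sup>2) \<partial>A) < \<infinity>" "(\<integral>\<^sup>+y. ennreal (y\<^sup>2) \<partial>B) < \<infinity>"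
    and k: "1 \<le> k"
  shows "W2_ast_cdf (record_cdf k (cdf A)) (record_cdf k (cdf B))"
  unfolding W2_ast_cdf_def
proof (rule tendsto_0_if_le_slope_bound)
  let ?C = "\<integral>\<^sup>+u\<in>{0<..<1}. ennreal ((quantile (cdf A) u - quantile (cdf B) u)\<^sup>2) \<partial>lborel"
  show "?C < \<infinity>"
    using finite by (intro le_less_trans[OF quantile_distance_le[OF A B]]) (simp add: ennreal_mult_less_top)
  fix m
  let ?p = "cdf B d"
  show "(\<integral>\<^sup>+u\<in>{u\<in>{0<..<1}. quantile (record_cdf k (cdf A) (Suc m)) u > quantile (record_cdf k (cdf B) (Suc m)) u}.
        ennreal ((quantile (record_cdf k (cdf A) (Suc m)) u - quantile (record_cdf k (cdf B) (Suc m)) u)\<^sup>2) \<partial>lborel)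
      \<le> ennreal (slope_bound k m ?p) * ?C"
    unfolding record_cdf_def[abs_def]
  proof (rule distorted_quantile_excess_le[OF A B refl p dom continuous_on_record_phi[OF k]
        strict_mono_on_record_phi[OF k] record_phi_0 record_phi_1])
    show "gamma_cdf m (hazard k v) = record_phi (Suc m) k v" if "v \<in> {0..?p}" for v
      using that p by (simp add: record_phi_eq_gamma_cdf)
    show "((\<lambda>v. gamma_cdf m (hazard k v)) has_real_derivative record_phi_deriv m k v) (at v)"
      if "v \<in> {0..?p}" for v
      using that p by (intro DERIV_gamma_cdf_hazard) simp
    show "continuous_on {0..?p} (record_phi_deriv m k)"
      using p by (rule continuous_on_record_phi_deriv)
    show "0 \<le> record_phi_deriv m k v" "record_phi_deriv m k v \<le> slope_bound k m ?p"
      if "v \<in> {0..?p}" for v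
      using that p by (simp_all add: record_phi_deriv_nonneg record_phi_deriv_le)
  qed
qed

text \<open>The conventional record laws are prescribed from index \<open>1\<close> on, so the orders have to be
  insensitive to the value at index \<open>0\<close>.\<close>

lemma L1_ast_cdf_cong:
  assumes "\<And>n. 1 \<le> n \<Longrightarrow> F n = F' n" "\<And>n. 1 \<le> n \<Longrightarrow> G n = G' n"
  shows "L1_ast_cdf F G \<longleftrightarrow> L1_ast_cdf F' G'"
  unfolding L1_ast_cdf_def
  by (intro tendsto_cong eventually_sequentiallyI[of 1]) (simp add: assms)

lemma W2_ast_cdf_cong:
  assumes "\<And>n. 1 \<le> n \<Longrightarrow> F n = F' n" "\<And>n. 1 \<le> n \<Longrightarrow> G n = G' n"
  shows "W2_ast_cdf F G \<longleftrightarrow> W2_ast_cdf F' G'"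
  unfolding W2_ast_cdf_def
  by (intro tendsto_cong eventually_sequentiallyI[of 1]) (simp add: assms)

theorem theorem7p12:
  fixes M :: "'a measure" and N :: "'b measure"
    and X :: "'a \<Rightarrow> real" and Y :: "'b \<Rightarrow> real"
    and Xs :: "nat \<Rightarrow> 'a \<Rightarrow> real" and Ys :: "nat \<Rightarrow> 'b \<Rightarrow> real"
    and F_X F_Y :: "real \<Rightarrow> real" and d :: real
  assumes "prob_space M" and "prob_space N"
    and "X \<in> borel_measurable M" and "F_X = cdf (distr M borel X)"
    and "Y \<in> borel_measurable N" and "F_Y = cdf (distr N borel Y)"
    and "F_Y d < 1" and "\<And>x. x \<ge> d \<Longrightarrow> F_X x \<ge> F_Y x"
    and "iid_with_cdf M Xs F_X" and "iid_with_cdf N Ys F_Y"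
  shows
    "(max (\<integral>\<^sup>+\<omega>. ennreal \<bar>X \<omega>\<bar> \<partial>M) (\<integral>\<^sup>+\<omega>. ennreal \<bar>Y \<omega>\<bar> \<partial>N) < \<infinity> \<longrightarrow>
        (\<forall>k\<ge>1. L1_ast_cdf (record_cdf k F_X) (record_cdf k F_Y) \<and>
          (has_record_law M Xs F_X k \<and> has_record_law N Ys F_Y k \<longrightarrow>
             L1_ast M (record_value k Xs) N (record_value k Ys)))) \<and>
     (max (\<integral>\<^sup>+\<omega>. ennreal ((X \<omega>)\<^sup>2) \<partial>M) (\<integral>\<^sup>+\<omega>. ennreal ((Y \<omega>)\<^sup>2) \<partial>N) < \<infinity> \<longrightarrow>
        (\<forall>k\<ge>1. W2_ast_cdf (record_cdf k F_X) (record_cdf k F_Y) \<and>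
          (has_record_law M Xs F_X k \<and> has_record_law N Ys F_Y k \<longrightarrow>
             W2_ast M (record_value k Xs) N (record_value k Ys))))"
proof -
  let ?A = "distr M borel X" and ?B = "distr N borel Y"
  have A: "real_distribution ?A" and B: "real_distribution ?B"
    using assms(1-3,5) by (simp_all add: prob_space.real_distribution_distr)
  have p: "cdf ?B d < 1" and dom: "\<And>x. d \<le> x \<Longrightarrow> cdf ?B x \<le> cdf ?A x"
    using assms by auto
  have L1: "L1_ast_cdf (record_cdf k F_X) (record_cdf k F_Y)"
    if "(\<integral>\<^sup>+\<omega>. ennreal \<bar>Y \<omega>\<bar> \<partial>N) < \<infinity>" "1 \<le> k" for k
    unfolding assms(4,6) using that assms(5)
    by (intro L1_ast_cdf_record_cdf[OF A B p dom]) (simp_all add: nn_integral_distr)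
  have W2: "W2_ast_cdf (record_cdf k F_X) (record_cdf k F_Y)"
    if "(\<integral>\<^sup>+\<omega>. ennreal ((X \<omega>)\<^sup>2) \<partial>M) < \<infinity>" "(\<integral>\<^sup>+\<omega>. ennreal ((Y \<omega>)\<^sup>2) \<partial>N) < \<infinity>" "1 \<le> k" for k
    unfolding assms(4,6) using that assms(3,5)
    by (intro W2_ast_cdf_record_cdf[OF A B p dom]) (simp_all add: nn_integral_distr)
  have "L1_ast M (record_value k Xs) N (record_value k Ys) \<longleftrightarrow>
      L1_ast_cdf (record_cdf k F_X) (record_cdf k F_Y)"
    "W2_ast M (record_value k Xs) N (record_value k Ys) \<longleftrightarrow>
      W2_ast_cdf (record_cdf k F_X) (record_cdf k F_Y)"
    if "has_record_law M Xs F_X k" "has_record_law N Ys F_Y k" for k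
    unfolding L1_ast_def W2_ast_def
    using that by (auto simp: has_record_law_def intro!: L1_ast_cdf_cong W2_ast_cdf_cong)
  with L1 W2 show ?thesis
    by auto
qed

end
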